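(* Let $G$ be the colored graph of a link diagram, with two distinct distinguished vertices $u,v$, and let $C$ be the colored graph of a rational tangle, also with two distinct distinguished vertices $u,v$. For $n\ge 0$ let $G_n$ be the graph obtained from $G$ by adding $n$ copies of $C$, each glued to $G$ by identifying its vertices $u,v$ with the vertices $u,v$ of $G$ (this is the graph of the diagram obtained by $n$ repeated rational surgeries). Let $W(G_n)=W(G_n)(d,d,d)$ denote the $W$-polynomial evaluated at $t=z_1=z_2=d$. Then $$W(G_n)=d^{-1-|V(G_n)|}\Big(a_{1,1}^{\,n}\,S_1(1-d^{-2})+(a_{1,1}+d^{2}a_{1,2})^{n}(S_1d^{-2}+S_2)\Big),$$ where $S_1,S_2,a_{1,1},a_{1,2}$ are the sums defined in the context.
   Context: $d=-A^{-2}-A^2$. Each edge $e$ of a colored graph has a color $f(e)$, and each color $\lambda$ has two weights $x_\lambda,y_\lambda$. $W$-polynomial: for a graph $H$, $$W(H)(t,z_1,z_2)=t^{k(H)-1}\sum_{S\subset E(H)}\Big\{\prod_{e\in S}x_{f(e)}\Big\}\Big\{\prod_{e\notin S}y_{f(e)}\Big\}z_1^{k(S)-k(H)}z_2^{n(S)},$$ where $S$ is regarded as the spanning subgraph with edge set $S$, $k(\cdot)$ is the number of connected components and $n(S)=|S|-|V(H)|+k(S)$. Graphs from diagrams: checkerboard color the link diagram (or tangle diagram); vertices are shaded regions and edges correspond to crossings (or to twist regions, suitably colored). For the tangle, $u$ and $v$ are the two shaded regions meeting the boundary of the tangle disk; in $G$, $u,v$ are the two shaded regions between which the tangles are inserted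 by surgery. States: a spanning subgraph is in state 1 if $u$ and $v$ lie in different connected components, and in state 2 if they lie in the same component. For a spanning subgraph $T$ of a graph $H$ containing $u,v$, and $S\subset E(C)$, let $T\cup S$ be the corresponding spanning subgraph of the graph obtained by gluing $C$ to $H$ along $u,v$, and let $\delta(T,S)=k(T\cup S)-k(T)$. Define $$a_{p,q}=\sum_{S}\Big\{\prod_{e\in S}x_{f(e)}\Big\}\Big\{\prod_{e\in E(C)\setminus S}y_{f(e)}\Big\}d^{|S|+2\delta(T,S)},$$ where $T$ is any fixed spanning subgraph in state $p$ and the sum is over those $S\subset E(C)$ for which $T\cup S$ is in state $q$ (the result depends only on $p,q$ and $C$). Also, for $j=1,2$, $$S_j=\sum_{S\subset E(G),\ S \text{ in state } j}\Big\{\prod_{e\in S}x_{f(e)}\Big\}\Big\{\prod_{e\in E(G)\setminus S}y_{f(e)}\Big\}d^{|S|+2k(S)}.$$ *)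

theory Defs
  imports "HOL-Analysis.Analysis" "HOL-Library.Uprod"
begin

section \<open>Coloured multigraphs (loops and parallel edges allowed)\<close>

record ('v, 'e, 'c) cgraph =
  verts :: "'v set"
  edges :: "'e set"
  ends :: "'e \<Rightarrow> 'v uprod"
  color :: "'e \<Rightarrow> 'c"

definition colored_graph :: "('v, 'e, 'c) cgraph \<Rightarrow> bool" where
  "colored_graph H \<longleftrightarrow> finite (verts H) \<and> finite (edges H) \<and>
     (\<forall>e\<in>edges H. set_uprod (ends H e) \<subseteq> verts H)"

text \<open>A spanning subgraph of \<open>H\<close> is given by its edge set \<open>S \<subseteq> edges H\<close>; its vertex set is
  always \<open>verts H\<close>.\<close>

definition joined :: "('v, 'e, 'c) cgraph \<Rightarrow> 'e set \<Rightarrow> ('v \<times> 'v) set" where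
  "joined H S = {(a, b). a \<in> verts H \<and> b \<in> verts H \<and>
     (a, b) \<in> {(a', b'). \<exists>e\<in>S. ends H e = Upair a' b'}\<^sup>*}"

definition num_components :: "('v, 'e, 'c) cgraph \<Rightarrow> 'e set \<Rightarrow> nat" where
  "num_components H S = card (verts H // joined H S)"

definition nullity :: "('v, 'e, 'c) cgraph \<Rightarrow> 'e set \<Rightarrow> int" where
  "nullity H S = int (card S) - int (card (verts H)) + int (num_components H S)"

definition weight :: "('c \<Rightarrow> 'k::field) \<Rightarrow> ('c \<Rightarrow> 'k) \<Rightarrow> ('v, 'e, 'c) cgraph \<Rightarrow> 'e set \<Rightarrow> 'k" where
  "weight x y H S = (\<Prod>e\<in>S. x (color H e)) * (\<Prod>e\<in>edges H - S. y (color H e))"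

text \<open>The exponents below are taken in the integers, so that no subtraction is truncated.\<close>

definition W_poly ::
  "('c \<Rightarrow> 'k::field) \<Rightarrow> ('c \<Rightarrow> 'k) \<Rightarrow> ('v, 'e, 'c) cgraph \<Rightarrow> 'k \<Rightarrow> 'k \<Rightarrow> 'k \<Rightarrow> 'k" where
  "W_poly x y H t z1 z2 =
     t powi (int (num_components H (edges H)) - 1) *
     (\<Sum>S\<in>Pow (edges H). weight x y H S *
        z1 powi (int (num_components H S) - int (num_components H (edges H))) *
        z2 powi nullity H S)"

definition loop_value :: "'k::field \<Rightarrow> 'k" where
  "loop_value A = - (A powi (- 2)) - A ^ 2"


section \<open>Gluing copies of a two-terminal graph\<close>

text \<open>\<open>copy_vertex u v u' v' i\<close> sends the vertices of the \<open>i\<close>-th copy of \<open>C\<close> to those of the glued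
  graph: the terminals \<open>u'\<close>, \<open>v'\<close> of \<open>C\<close> become the vertices \<open>u\<close>, \<open>v\<close> of \<open>H\<close>.\<close>

definition copy_vertex :: "'v \<Rightarrow> 'v \<Rightarrow> 'w \<Rightarrow> 'w \<Rightarrow> nat \<Rightarrow> 'w \<Rightarrow> 'v + nat \<times> 'w" where
  "copy_vertex u v u' v' i w = (if w = u' then Inl u else if w = v' then Inl v else Inr (i, w))"

definition glue_copies ::
  "nat \<Rightarrow> ('v, 'e, 'c) cgraph \<Rightarrow> 'v \<Rightarrow> 'v \<Rightarrow> ('w, 'f, 'c) cgraph \<Rightarrow> 'w \<Rightarrow> 'w \<Rightarrow>
   ('v + nat \<times> 'w, 'e + nat \<times> 'f, 'c) cgraph" where
  "glue_copies n H u v C u' v' =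
     \<lparr> verts = Inl ` verts H \<union> (\<Union>i<n. copy_vertex u v u' v' i ` verts C),
       edges = Inl ` edges H \<union> Inr ` ({..<n} \<times> edges C),
       ends = case_sum (\<lambda>e. map_uprod Inl (ends H e))
                       (\<lambda>(i, e). map_uprod (copy_vertex u v u' v' i) (ends C e)),
       color = case_sum (color H) (\<lambda>(i, e). color C e) \<rparr>"


section \<open>States and the associated sums\<close>

definition state :: "('v, 'e, 'c) cgraph \<Rightarrow> 'v \<Rightarrow> 'v \<Rightarrow> 'e set \<Rightarrow> nat" where
  "state H u v S = (if (u, v) \<in> joined H S then 2 else 1)"

definition state_sum ::
  "('c \<Rightarrow> 'k::field) \<Rightarrow> ('c \<Rightarrow> 'k) \<Rightarrow> 'k \<Rightarrow> ('v, 'e, 'c) cgraph \<Rightarrow> 'v \<Rightarrow> 'v \<Rightarrow> nat \<Rightarrow> 'k" where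
  "state_sum x y d G u v j =
     (\<Sum>S\<in>{S. S \<subseteq> edges G \<and> state G u v S = j}.
        weight x y G S * d ^ (card S + 2 * num_components G S))"

text \<open>\<open>union_edges T S\<close> is the edge set of the spanning subgraph \<open>T \<union> S\<close> of
  \<open>glue_copies 1 H u v C u' v'\<close>.\<close>

definition union_edges :: "'e set \<Rightarrow> 'f set \<Rightarrow> ('e + nat \<times> 'f) set" where
  "union_edges T S = Inl ` T \<union> Inr ` ({0} \<times> S)"

definition comp_change ::
  "('h, 'e, 'c) cgraph \<Rightarrow> 'h \<Rightarrow> 'h \<Rightarrow> 'e set \<Rightarrow> ('w, 'f, 'c) cgraph \<Rightarrow> 'w \<Rightarrow> 'w \<Rightarrow> 'f set \<Rightarrow> int" where
  "comp_change H u v T C u' v' S =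
     int (num_components (glue_copies 1 H u v C u' v') (union_edges T S)) - int (num_components H T)"

text \<open>\<open>transfer_sum x y d H u v T C u' v' q\<close> is the coefficient \<open>a\<^bsub>p,q\<^esub>\<close> computed from the spanning
  subgraph \<open>T\<close> of \<open>H\<close>, where \<open>p = state H u v T\<close>.\<close>

definition transfer_sum ::
  "('c \<Rightarrow> 'k::field) \<Rightarrow> ('c \<Rightarrow> 'k) \<Rightarrow> 'k \<Rightarrow>
   ('h, 'e, 'c) cgraph \<Rightarrow> 'h \<Rightarrow> 'h \<Rightarrow> 'e set \<Rightarrow> ('w, 'f, 'c) cgraph \<Rightarrow> 'w \<Rightarrow> 'w \<Rightarrow> nat \<Rightarrow> 'k" where
  "transfer_sum x y d H u v T C u' v' q =
     (\<Sum>S\<in>{S. S \<subseteq> edges C \<and>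
              state (glue_copies 1 H u v C u' v') (Inl u) (Inl v) (union_edges T S) = q}.
        weight x y C S * d powi (int (card S) + 2 * comp_change H u v T C u' v' S))"


section \<open>Checkerboard-coloured link diagrams and their graphs\<close>

text \<open>A diagram is drawn in the plane by its projection \<open>P\<close>, with a finite set \<open>X\<close> of crossing
  sites. The set \<open>B\<close> consists of the shaded regions, i.e. of the shaded connected components of the
  complement of \<open>P\<close>. A site carries either a single crossing or a twist region contracted to a
  point; which of these it is, and with which over/under information, is recorded only by the
  colour of the corresponding edge.\<close>

definition disc_chart :: "(complex \<Rightarrow> complex) \<Rightarrow> complex \<Rightarrow> bool" where
  "disc_chart h p \<longleftrightarrow> h 0 = p \<and> open (h ` ball 0 1) \<and>
     (\<exists>g. homeomorphism (ball 0 1) (h ` ball 0 1) h g)"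

text \<open>Near a regular point \<open>P\<close> is an arc with exactly one shaded side.\<close>

definition arc_point :: "complex set \<Rightarrow> complex set set \<Rightarrow> complex \<Rightarrow> bool" where
  "arc_point P B p \<longleftrightarrow> (\<exists>h. disc_chart h p \<and>
     P \<inter> h ` ball 0 1 = h ` {z \<in> ball 0 1. Im z = 0} \<and>
     (\<exists>R\<in>B. h ` {z \<in> ball 0 1. Im z > 0} \<subseteq> R) \<and>
     h ` {z \<in> ball 0 1. Im z < 0} \<inter> \<Union>B = {})"

text \<open>Near a crossing site \<open>P\<close> consists of two arcs crossing each other, and of the four local
  quadrants exactly two opposite ones are shaded; they belong to the (possibly equal) regions
  \<open>R\<close> and \<open>R'\<close>.\<close>

definition crossing_site ::
  "complex set \<Rightarrow> complex set set \<Rightarrow> complex \<Rightarrow> complex set \<Rightarrow> complex set \<Rightarrow> bool" where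
  "crossing_site P B c R R' \<longleftrightarrow> R \<in> B \<and> R' \<in> B \<and> (\<exists>h. disc_chart h c \<and>
     P \<inter> h ` ball 0 1 = h ` {z \<in> ball 0 1. Re z = 0 \<or> Im z = 0} \<and>
     h ` {z \<in> ball 0 1. Re z > 0 \<and> Im z > 0} \<subseteq> R \<and>
     h ` {z \<in> ball 0 1. Re z < 0 \<and> Im z < 0} \<subseteq> R' \<and>
     h ` {z \<in> ball 0 1. Re z * Im z < 0} \<inter> \<Union>B = {})"

definition shaded_diagram :: "complex set \<Rightarrow> complex set \<Rightarrow> complex set set \<Rightarrow> bool" where
  "shaded_diagram P X B \<longleftrightarrow> compact P \<and> finite X \<and> X \<subseteq> P \<and> B \<subseteq> components (- P) \<and>
     (\<forall>p\<in>P - X. arc_point P B p) \<and> (\<forall>c\<in>X. \<exists>R R'. crossing_site P B c R R')"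

definition link_diagram_graph :: "('v, 'e, 'c) cgraph \<Rightarrow> bool" where
  "link_diagram_graph G \<longleftrightarrow> colored_graph G \<and>
     (\<exists>P X B region site. shaded_diagram P X B \<and>
        bij_betw region (verts G) B \<and> bij_betw site (edges G) X \<and>
        (\<forall>e\<in>edges G. \<exists>a\<in>verts G. \<exists>b\<in>verts G.
           ends G e = Upair a b \<and> crossing_site P B (site e) (region a) (region b)))"


section \<open>Rational tangles and their graphs\<close>

text \<open>A rational tangle diagram arises from one of the two trivial tangles (two horizontal arcs,
  respectively two vertical arcs) by successively twisting two neighbouring end points on one of
  the four sides. As above, the colour attached to a twist records the kind of the crossing, or of
  the whole twist region.\<close>

datatype 'c rational_tangle =
    Horizontal_arcs
  | Vertical_arcs
  | Twist_east "'c rational_tangle" 'c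
  | Twist_west "'c rational_tangle" 'c
  | Twist_north "'c rational_tangle" 'c
  | Twist_south "'c rational_tangle" 'c

text \<open>\<open>tangle_graph \<tau> C u v\<close>: \<open>C\<close> is the graph of \<open>\<tau>\<close> when the west and east boundary regions \<open>u\<close>
  and \<open>v\<close> are shaded; vertex and edge names are arbitrary. The other checkerboard colouring is
  obtained by a quarter turn of \<open>\<tau>\<close>, which interchanges the two trivial tangles, and the
  horizontal and vertical twists.

  West and east are the same region for two horizontal arcs, and distinct for two vertical arcs.
  The crossing of an east (west) twist separates, horizontally, the former east (west) region,
  which becomes an inner region, from a new one. The crossing of a north or south twist has the
  west and east regions as its shaded quadrants.\<close>

inductive tangle_graph ::
  "'c rational_tangle \<Rightarrow> ('w, 'f, 'c) cgraph \<Rightarrow> 'w \<Rightarrow> 'w \<Rightarrow> bool" where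
  horizontal: "verts C = {u} \<Longrightarrow> edges C = {} \<Longrightarrow> tangle_graph Horizontal_arcs C u u"
| vertical: "u \<noteq> v \<Longrightarrow> verts C = {u, v} \<Longrightarrow> edges C = {} \<Longrightarrow> tangle_graph Vertical_arcs C u v"
| east: "tangle_graph \<tau> C u v \<Longrightarrow> w \<notin> verts C \<Longrightarrow> e \<notin> edges C \<Longrightarrow>
    tangle_graph (Twist_east \<tau> c)
      \<lparr> verts = insert w (verts C), edges = insert e (edges C),
        ends = (ends C)(e := Upair v w), color = (color C)(e := c) \<rparr> u w"
| west: "tangle_graph \<tau> C u v \<Longrightarrow> w \<notin> verts C \<Longrightarrow> e \<notin> edges C \<Longrightarrow>
    tangle_graph (Twist_west \<tau> c)
      \<lparr> verts = insert w (verts C), edges = insert e (edges C),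
        ends = (ends C)(e := Upair w u), color = (color C)(e := c) \<rparr> w v"
| north: "tangle_graph \<tau> C u v \<Longrightarrow> e \<notin> edges C \<Longrightarrow>
    tangle_graph (Twist_north \<tau> c)
      \<lparr> verts = verts C, edges = insert e (edges C),
        ends = (ends C)(e := Upair u v), color = (color C)(e := c) \<rparr> u v"
| south: "tangle_graph \<tau> C u v \<Longrightarrow> e \<notin> edges C \<Longrightarrow>
    tangle_graph (Twist_south \<tau> c)
      \<lparr> verts = verts C, edges = insert e (edges C),
        ends = (ends C)(e := Upair u v), color = (color C)(e := c) \<rparr> u v"

end

theory Submission
  imports Defs
begin

text \<open>Gluing along two vertices adds the numbers of components and subtracts 2, or only 1 if the two
  vertices are joined on both sides. At \<open>t = z\<^sub>1 = z\<^sub>2 = d\<close> the \<open>W\<close>-polynomial is a multiple of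
  \<open>Z\<^sub>1 + Z\<^sub>2\<close>, where \<open>Z\<^sub>j\<close> sums \<open>d\<close> to the power \<open>|S| + 2 k(S)\<close> over the spanning subgraphs in state \<open>j\<close>.
  Hence one more copy of \<open>C\<close> sends \<open>(Z\<^sub>1, Z\<^sub>2)\<close> to
  \<open>(a\<^sub>1\<^sub>1 Z\<^sub>1, a\<^sub>1\<^sub>2 Z\<^sub>1 + (a\<^sub>1\<^sub>1 + d\<^sup>2 a\<^sub>1\<^sub>2) Z\<^sub>2)\<close>, a triangular map with eigenfunctionals
  \<open>Z\<^sub>1\<close> and \<open>d\<^sup>-\<^sup>2 Z\<^sub>1 + Z\<^sub>2\<close>.\<close>

section \<open>Components of a union along two vertices\<close>

text \<open>Single steps along edges, before taking the closure: gluing acts on these as a plain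
  union, which it does not do on \<open>joined\<close>.\<close>

definition adjacency :: "('v, 'e, 'c) cgraph \<Rightarrow> 'e set \<Rightarrow> ('v \<times> 'v) set" where
  "adjacency H S = {(a, b). \<exists>e\<in>S. ends H e = Upair a b}"

lemma joined_adjacency: "joined H S = (adjacency H S)\<^sup>* \<inter> verts H \<times> verts H"
  by (auto simp: joined_def adjacency_def)

lemma sym_adjacency: "sym (adjacency H S)"
proof (rule symI)
  fix a b assume "(a, b) \<in> adjacency H S"
  then obtain e where e: "e \<in> S" "ends H e = Upair a b" by (auto simp: adjacency_def)
  moreover have "Upair a b = Upair b a" by simp
  ultimately show "(b, a) \<in> adjacency H S" by (auto simp del: Upair_inject simp: adjacency_def)
qed

lemma equiv_rtrancl_Int:
  assumes "sym r"
  shows "equiv V (r\<^sup>* \<inter> V \<times> V)"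
proof (rule equivI)
  show "sym (r\<^sup>* \<inter> V \<times> V)"
    using sym_rtrancl[OF assms] by (auto simp: sym_def)
  show "trans (r\<^sup>* \<inter> V \<times> V)"
    by (rule transI) (blast intro: rtrancl_trans)
qed (auto simp: refl_on_def)

lemma equiv_joined: "equiv (verts H) (joined H S)"
  unfolding joined_adjacency by (rule equiv_rtrancl_Int[OF sym_adjacency])

lemma adjacency_subset:
  assumes "colored_graph H" "S \<subseteq> edges H"
  shows "adjacency H S \<subseteq> verts H \<times> verts H"
proof safe
  fix a b assume "(a, b) \<in> adjacency H S"
  then obtain e where "e \<in> S" "ends H e = Upair a b" by (auto simp: adjacency_def)
  moreover have "set_uprod (ends H e) \<subseteq> verts H" if "e \<in> S"
    using that assms by (auto simp: colored_graph_def)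
  ultimately show "a \<in> verts H" "b \<in> verts H" by simp_all
qed

lemma rtrancl_closed:
  assumes "(x, y) \<in> r\<^sup>*" "x \<in> X" "r `` X \<subseteq> X"
  shows "y \<in> X"
  using Image_closed_trancl[OF assms(3)] assms(1,2) by (metis ImageI)

text \<open>Closing each relation first adds only pairs already reachable in the union. Thus the
  components of a glued graph depend only on the component relations of its two sides.\<close>

lemma rtrancl_Un_joined:
  assumes "r\<^sub>1 \<subseteq> V\<^sub>1 \<times> V\<^sub>1" "r\<^sub>2 \<subseteq> V\<^sub>2 \<times> V\<^sub>2"
  shows "(r\<^sub>1 \<union> r\<^sub>2)\<^sup>* = (r\<^sub>1\<^sup>* \<inter> V\<^sub>1 \<times> V\<^sub>1 \<union> r\<^sub>2\<^sup>* \<inter> V\<^sub>2 \<times> V\<^sub>2)\<^sup>*" (is "_ = ?R\<^sup>*")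
proof (rule rtrancl_subset[symmetric])
  show "r\<^sub>1 \<union> r\<^sub>2 \<subseteq> ?R" using assms by auto
  show "?R \<subseteq> (r\<^sub>1 \<union> r\<^sub>2)\<^sup>*" using rtrancl_mono[of r\<^sub>1 "r\<^sub>1 \<union> r\<^sub>2"] rtrancl_mono[of r\<^sub>2 "r\<^sub>1 \<union> r\<^sub>2"] by auto
qed

text \<open>Gluing in terms of partitions: the classes of \<open>R\<^sub>1\<close> and
  \<open>R\<^sub>2\<close> stand for the components of two graphs that share the vertices
  \<open>p\<close> and \<open>q\<close>.\<close>

locale two_vertex_union =
  fixes V\<^sub>1 V\<^sub>2 :: "'a set" and R\<^sub>1 R\<^sub>2 :: "('a \<times> 'a) set" and p q :: 'a
  assumes equiv\<^sub>1: "equiv V\<^sub>1 R\<^sub>1" and equiv\<^sub>2: "equiv V\<^sub>2 R\<^sub>2"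
    and fin\<^sub>1: "finite V\<^sub>1" and fin\<^sub>2: "finite V\<^sub>2"
    and Int: "V\<^sub>1 \<inter> V\<^sub>2 = {p, q}"
begin

definition J where "J = (R\<^sub>1 \<union> R\<^sub>2)\<^sup>* \<inter> (V\<^sub>1 \<union> V\<^sub>2) \<times> (V\<^sub>1 \<union> V\<^sub>2)"

text \<open>By this symmetry, results about classes on the first side carry over to the
  second.\<close>

lemma swap: "two_vertex_union V\<^sub>2 V\<^sub>1 R\<^sub>2 R\<^sub>1 p q"
  using two_vertex_union_axioms by (auto simp: two_vertex_union_def)

lemma equiv_J: "equiv (V\<^sub>1 \<union> V\<^sub>2) J"
  unfolding J_def using equiv\<^sub>1 equiv\<^sub>2 by (intro equiv_rtrancl_Int sym_Un) (auto simp: equiv_def)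

lemma subset\<^sub>1: "R\<^sub>1 \<subseteq> J" and subset\<^sub>2: "R\<^sub>2 \<subseteq> J"
  using equiv\<^sub>1 equiv\<^sub>2 by (auto simp: J_def equiv_def)

lemma terminals: "p \<in> V\<^sub>1" "q \<in> V\<^sub>1" "p \<in> V\<^sub>2" "q \<in> V\<^sub>2"
  using Int by auto

text \<open>If neither relation links \<open>p\<close> to \<open>q\<close>, then \<open>p\<close> is
  the only common vertex in the union of its two classes, so that union is closed under both
  relations and misses \<open>q\<close>.\<close>

lemma J_terminals_iff: "(p, q) \<in> J \<longleftrightarrow> (p, q) \<in> R\<^sub>1 \<or> (p, q) \<in> R\<^sub>2"
proof
  assume J: "(p, q) \<in> J"
  show "(p, q) \<in> R\<^sub>1 \<or> (p, q) \<in> R\<^sub>2"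
  proof (rule ccontr)
    assume not: "\<not> ((p, q) \<in> R\<^sub>1 \<or> (p, q) \<in> R\<^sub>2)"
    let ?X = "R\<^sub>1 `` {p} \<union> R\<^sub>2 `` {p}"
    have "(R\<^sub>1 \<union> R\<^sub>2) `` ?X \<subseteq> ?X"
    proof
      fix z assume "z \<in> (R\<^sub>1 \<union> R\<^sub>2) `` ?X"
      then obtain y where y: "(p, y) \<in> R\<^sub>1 \<or> (p, y) \<in> R\<^sub>2" "(y, z) \<in> R\<^sub>1 \<or> (y, z) \<in> R\<^sub>2"
        by auto
      have "y = p" if "y \<in> V\<^sub>1" "y \<in> V\<^sub>2" using that Int y(1) not by auto
      then show "z \<in> ?X"
        using y equiv\<^sub>1 equiv\<^sub>2 unfolding equiv_def by (auto dest: transD)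
    qed
    moreover have "p \<in> ?X" using equiv_class_self[OF equiv\<^sub>1] terminals by simp
    ultimately have "q \<in> ?X" using J rtrancl_closed[of p q "R\<^sub>1 \<union> R\<^sub>2" ?X] unfolding J_def by simp
    then show False using not by auto
  qed
qed (use subset\<^sub>1 subset\<^sub>2 in auto)

text \<open>A class avoiding \<open>p\<close> and \<open>q\<close> contains no vertex of
  \<open>V\<^sub>2\<close>, so no step of \<open>R\<^sub>2\<close> can leave it.\<close>

lemma J_class:
  assumes "x \<in> V\<^sub>1" "(x, p) \<notin> R\<^sub>1" "(x, q) \<notin> R\<^sub>1"
  shows "J `` {x} = R\<^sub>1 `` {x}"
proof
  have "(R\<^sub>1 \<union> R\<^sub>2) `` (R\<^sub>1 `` {x}) \<subseteq> R\<^sub>1 `` {x}"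
  proof
    fix z assume "z \<in> (R\<^sub>1 \<union> R\<^sub>2) `` (R\<^sub>1 `` {x})"
    then obtain y where y: "(x, y) \<in> R\<^sub>1" "(y, z) \<in> R\<^sub>1 \<or> (y, z) \<in> R\<^sub>2" by auto
    then have "y \<in> V\<^sub>1" "y \<notin> {p, q}" using equiv\<^sub>1 assms by (auto simp: equiv_def)
    then have "y \<notin> V\<^sub>2" using Int by blast
    then show "z \<in> R\<^sub>1 `` {x}" using y equiv\<^sub>1 equiv\<^sub>2 unfolding equiv_def by (auto dest: transD)
  qed
  moreover have "x \<in> R\<^sub>1 `` {x}" using equiv_class_self[OF equiv\<^sub>1] assms by simp
  ultimately show "J `` {x} \<subseteq> R\<^sub>1 `` {x}"
    using rtrancl_closed[of x _ "R\<^sub>1 \<union> R\<^sub>2" "R\<^sub>1 `` {x}"] unfolding J_def by auto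
qed (use subset\<^sub>1 in auto)

text \<open>The classes on the first side that the union leaves unchanged.\<close>

definition free where "free = V\<^sub>1 // R\<^sub>1 - {R\<^sub>1 `` {p}, R\<^sub>1 `` {q}}"

lemma free_class:
  assumes "X \<in> free"
  obtains x where "x \<in> V\<^sub>1" "(x, p) \<notin> R\<^sub>1" "(x, q) \<notin> R\<^sub>1" "X = R\<^sub>1 `` {x}"
proof -
  from assms obtain x where x: "x \<in> V\<^sub>1" "X = R\<^sub>1 `` {x}" "X \<noteq> R\<^sub>1 `` {p}" "X \<noteq> R\<^sub>1 `` {q}"
    unfolding free_def by (metis DiffD1 DiffD2 insertCI quotientE)
  then have "(x, p) \<notin> R\<^sub>1" "(x, q) \<notin> R\<^sub>1" using equiv_class_eq[OF equiv\<^sub>1] by auto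
  with x(1,2) show thesis by (intro that)
qed

lemma free_J:
  assumes "X \<in> free"
  shows "X \<in> (V\<^sub>1 \<union> V\<^sub>2) // J" "X \<noteq> {}" "X \<subseteq> V\<^sub>1 - {p, q}"
proof -
  obtain x where x: "x \<in> V\<^sub>1" "(x, p) \<notin> R\<^sub>1" "(x, q) \<notin> R\<^sub>1" "X = R\<^sub>1 `` {x}"
    using free_class[OF assms] .
  show "X \<in> (V\<^sub>1 \<union> V\<^sub>2) // J" using x J_class by (metis UnI1 quotientI)
  show "X \<noteq> {}" "X \<subseteq> V\<^sub>1 - {p, q}" using x equiv\<^sub>1 by (auto simp: equiv_def refl_on_def)
qed

lemma class_cases:
  assumes "x \<in> V\<^sub>1"
  shows "J `` {x} \<in> free \<union> {J `` {p}, J `` {q}}"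
proof (cases "(x, p) \<in> R\<^sub>1 \<or> (x, q) \<in> R\<^sub>1")
  case True
  then have "J `` {x} = J `` {p} \<or> J `` {x} = J `` {q}"
    using subset\<^sub>1 by (metis equiv_class_eq[OF equiv_J] subsetD)
  then show ?thesis by auto
next
  case False
  then have "R\<^sub>1 `` {x} \<noteq> R\<^sub>1 `` {p}" "R\<^sub>1 `` {x} \<noteq> R\<^sub>1 `` {q}"
    using eq_equiv_class_iff[OF equiv\<^sub>1] assms terminals by simp_all
  then show ?thesis
    using J_class False assms by (auto simp: free_def quotientI)
qed

lemma card_free: "int (card free) = int (card (V\<^sub>1 // R\<^sub>1)) - (if (p, q) \<in> R\<^sub>1 then 1 else 2)"
proof -
  let ?P = "{R\<^sub>1 `` {p}, R\<^sub>1 `` {q}}"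
  have fin: "finite (V\<^sub>1 // R\<^sub>1)"
    using equiv\<^sub>1 fin\<^sub>1 by (auto intro: finite_quotient simp: equiv_def)
  have sub: "?P \<subseteq> V\<^sub>1 // R\<^sub>1" using terminals by (auto intro: quotientI)
  have "(R\<^sub>1 `` {p} = R\<^sub>1 `` {q}) = ((p, q) \<in> R\<^sub>1)"
    using eq_equiv_class_iff[OF equiv\<^sub>1] terminals by simp
  then have "card ?P = (if (p, q) \<in> R\<^sub>1 then 1 else 2)" by auto
  then show ?thesis unfolding free_def
    using card_Diff_subset[OF _ sub] card_mono[OF fin sub] by (auto simp: of_nat_diff)
qed

text \<open>The classes of \<open>J\<close> are the untouched ones of both sides and those of
  \<open>p\<close> and \<open>q\<close>. Passing from the terminal classes of the two sides to those
  of \<open>J\<close> changes their number from 2 to 1, from 3 to 1 or from 4 to 2: the loss is 1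
  only if both sides link \<open>p\<close> and \<open>q\<close>.\<close>

lemma card_quotient_J:
  "int (card ((V\<^sub>1 \<union> V\<^sub>2) // J)) = int (card (V\<^sub>1 // R\<^sub>1)) + int (card (V\<^sub>2 // R\<^sub>2))
     - (if (p, q) \<in> R\<^sub>1 \<and> (p, q) \<in> R\<^sub>2 then 1 else 2)"
proof -
  interpret sw: two_vertex_union V\<^sub>2 V\<^sub>1 R\<^sub>2 R\<^sub>1 p q by (rule swap)
  have J: "sw.J = J" unfolding J_def sw.J_def by (simp add: Un_commute)
  let ?P = "{J `` {p}, J `` {q}}"
  have P: "p \<in> J `` {p}" "q \<in> J `` {q}"
    using equiv_class_self[OF equiv_J] terminals by auto
  have "(J `` {p} = J `` {q}) = ((p, q) \<in> J)"
    using eq_equiv_class_iff[OF equiv_J] terminals by simp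
  then have cP: "card ?P = (if (p, q) \<in> J then 1 else 2)" by auto
  have "free \<union> sw.free \<union> ?P = (V\<^sub>1 \<union> V\<^sub>2) // J" (is "?L = ?Q")
  proof
    show "?L \<subseteq> ?Q"
      using free_J(1) sw.free_J(1) J terminals by (auto simp: Un_commute intro: quotientI)
    show "?Q \<subseteq> ?L"
      using class_cases sw.class_cases J by (auto elim!: quotientE)
  qed
  moreover have "free \<inter> sw.free = {}"
  proof -
    have False if "X \<in> free" "X \<in> sw.free" for X
      using free_J(2,3)[OF that(1)] sw.free_J(3)[OF that(2)] Int by blast
    then show ?thesis by blast
  qed
  moreover have "(free \<union> sw.free) \<inter> ?P = {}"
  proof -
    have "p \<notin> X \<and> q \<notin> X" if "X \<in> free \<union> sw.free" for X
      using that free_J(3)[of X] sw.free_J(3)[of X] by blast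
    then show ?thesis using P by blast
  qed
  moreover have "finite free" "finite sw.free"
    using equiv\<^sub>1 fin\<^sub>1 equiv\<^sub>2 fin\<^sub>2 unfolding free_def sw.free_def
    by (auto intro: finite_quotient simp: equiv_def)
  ultimately have "card ((V\<^sub>1 \<union> V\<^sub>2) // J) = card free + card sw.free + card ?P"
    by (metis card_Un_disjoint finite.emptyI finite.insertI finite_Un)
  then show ?thesis
    using card_free sw.card_free cP J_terminals_iff by auto
qed

end

section \<open>Relations transported along an injection\<close>

text \<open>Every step of the image relation ends in the range of \<open>f\<close>, so a path from
  \<open>f a\<close> can be pulled back step by step by injectivity.\<close>

lemma rtrancl_map_prod_iff:
  assumes "inj f"
  shows "(f a, f b) \<in> (map_prod f f ` r)\<^sup>* \<longleftrightarrow> (a, b) \<in> r\<^sup>*"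
proof
  have "\<exists>b. z = f b \<and> (a, b) \<in> r\<^sup>*" if "(f a, z) \<in> (map_prod f f ` r)\<^sup>*" for z
    using that
  proof induction
    case (step y z)
    then obtain b c where "y = f b" "(a, b) \<in> r\<^sup>*" "(b, c) \<in> r" "z = f c"
      using assms by (auto dest: injD)
    then show ?case by (blast intro: rtrancl_into_rtrancl)
  qed auto
  then show "(a, b) \<in> r\<^sup>*" if "(f a, f b) \<in> (map_prod f f ` r)\<^sup>*"
    using that assms by (metis injD)
next
  show "(f a, f b) \<in> (map_prod f f ` r)\<^sup>*" if "(a, b) \<in> r\<^sup>*"
    using that
  proof induction
    case (step b c)
    have "(f b, f c) \<in> map_prod f f ` r" using step.hyps(2) by force
    with step.IH show ?case by (rule rtrancl_into_rtrancl)
  qed auto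
qed

lemma rtrancl_map_prod_Int:
  assumes "inj f"
  shows "(map_prod f f ` r)\<^sup>* \<inter> f ` V \<times> f ` V = map_prod f f ` (r\<^sup>* \<inter> V \<times> V)"
  using rtrancl_map_prod_iff[OF assms] by force

lemma map_prod_mem_iff:
  assumes "inj f"
  shows "(f a, f b) \<in> map_prod f f ` R \<longleftrightarrow> (a, b) \<in> R"
  using assms by (auto dest: injD)

text \<open>The classes of the image relation are the images of the classes, and taking images under
  an injection is injective on sets.\<close>

lemma card_quotient_map_prod:
  assumes "inj f"
  shows "card (f ` V // (map_prod f f ` R)) = card (V // R)"
proof -
  have "(map_prod f f ` R) `` {f a} = f ` (R `` {a})" for a
    using assms by (auto simp: image_iff dest: injD)
  then have "f ` V // (map_prod f f ` R) = (`) f ` (V // R)"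
    unfolding quotient_def by auto
  then show ?thesis
    using card_image[OF inj_on_image[OF inj_on_subset[OF assms subset_UNIV]]] by simp
qed

lemma equiv_map_prod:
  assumes "equiv V R" "inj f"
  shows "equiv (f ` V) (map_prod f f ` R)"
proof (rule equivI)
  show "trans (map_prod f f ` R)"
    using assms by (force simp: equiv_def trans_def dest: injD)
qed (use assms in \<open>auto simp: equiv_def refl_on_def sym_def\<close>)

section \<open>Adding one copy of the two-terminal graph\<close>

text \<open>\<open>Upair\<close> is symmetric, so the preimages can always be listed in the order of
  \<open>a\<close> and \<open>b\<close>.\<close>

lemma map_uprod_eq_Upair_iff:
  "map_uprod f z = Upair a b \<longleftrightarrow> (\<exists>a' b'. z = Upair a' b' \<and> a = f a' \<and> b = f b')"
proof (cases z)
  case (Upair c d)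
  then show ?thesis by auto
qed

lemma state_eq_1_or_2: "state H u v S = 1 \<or> state H u v S = 2"
  by (simp add: state_def)

text \<open>\<open>H\<close> stays arbitrary: it will be \<open>G\<close> in the recurrence, and
  also each host graph of the transfer sums.\<close>

locale gluing =
  fixes H :: "('v, 'e, 'c) cgraph" and u v :: 'v and C :: "('w, 'f, 'c) cgraph" and u' v' :: 'w
  assumes H: "colored_graph H" "u \<in> verts H" "v \<in> verts H" "u \<noteq> v"
    and C: "colored_graph C" "u' \<in> verts C" "v' \<in> verts C" "u' \<noteq> v'"
begin

abbreviation copy where "copy \<equiv> copy_vertex u v u' v'"

abbreviation glued where "glued n \<equiv> glue_copies n H u v C u' v'"

abbreviation copy_edges :: "nat \<Rightarrow> 'f set \<Rightarrow> ('e + nat \<times> 'f) set" where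
  "copy_edges n S \<equiv> Inr ` ({n} \<times> S)"

lemma inj_copy: "inj (copy n)"
  using H C by (auto simp: inj_def copy_vertex_def)

lemma verts_glued_Suc: "verts (glued (Suc n)) = verts (glued n) \<union> copy n ` verts C"
  by (auto simp: glue_copies_def lessThan_Suc)

lemma edges_glued_Suc: "edges (glued (Suc n)) = edges (glued n) \<union> copy_edges n (edges C)"
  by (auto simp: glue_copies_def lessThan_Suc)

lemma edges_glued_disjoint:
  assumes "S \<subseteq> edges (glued n)"
  shows "S \<inter> copy_edges n S' = {}"
  using assms by (auto simp: glue_copies_def)

lemma finite_verts_glued: "finite (verts (glued n))"
  using H C by (auto simp: glue_copies_def colored_graph_def)

lemma finite_edges_glued: "finite (edges (glued n))"
  using H C by (auto simp: glue_copies_def colored_graph_def)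

lemma colored_graph_glued: "colored_graph (glued n)"
proof -
  have "set_uprod (ends (glued n) e) \<subseteq> verts (glued n)" if e: "e \<in> edges (glued n)" for e
  proof (cases e)
    case (Inl e')
    then have "set_uprod (ends H e') \<subseteq> verts H"
      using e H by (auto simp: glue_copies_def colored_graph_def)
    then show ?thesis by (auto simp: Inl glue_copies_def uprod.set_map)
  next
    case (Inr ie)
    obtain i e' where ie: "ie = (i, e')" by fastforce
    then have "i < n" "set_uprod (ends C e') \<subseteq> verts C"
      using e C Inr by (auto simp: glue_copies_def colored_graph_def)
    then show ?thesis by (auto simp: Inr ie glue_copies_def uprod.set_map)
  qed
  then show ?thesis
    using finite_verts_glued finite_edges_glued by (simp add: colored_graph_def)
qed

text \<open>Inner vertices of the new copy carry the index \<open>n\<close>, those of the copies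
  already present smaller ones.\<close>

lemma verts_glued_Int_copy: "verts (glued n) \<inter> copy n ` verts C = {Inl u, Inl v}"
  using H C by (auto simp: glue_copies_def copy_vertex_def image_iff split: if_splits)

text \<open>The function \<open>ends\<close> of a glued graph does not depend on the number of
  copies, so the edges of \<open>S\<close> keep their ends.\<close>

lemma adjacency_glued_Suc:
  "adjacency (glued (Suc n)) (S \<union> copy_edges n S') =
     adjacency (glued n) S \<union> map_prod (copy n) (copy n) ` adjacency C S'"
  by (force simp: adjacency_def glue_copies_def map_uprod_eq_Upair_iff)

lemma adjacency_glued_0: "adjacency (glued 0) (Inl ` T) = map_prod Inl Inl ` adjacency H T"
  by (force simp: adjacency_def glue_copies_def map_uprod_eq_Upair_iff)

lemma joined_glued_0: "joined (glued 0) (Inl ` T) = map_prod Inl Inl ` joined H T"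
proof -
  have "verts (glued 0) = Inl ` verts H" by (simp add: glue_copies_def)
  then show ?thesis
    by (simp only: joined_adjacency adjacency_glued_0 rtrancl_map_prod_Int inj_Inl)
qed

lemma num_components_glued_0: "num_components (glued 0) (Inl ` T) = num_components H T"
proof -
  have "verts (glued 0) = Inl ` verts H" by (simp add: glue_copies_def)
  then show ?thesis
    by (simp only: num_components_def joined_glued_0 card_quotient_map_prod inj_Inl)
qed

lemma state_glued_0: "state (glued 0) (Inl u) (Inl v) (Inl ` T) = state H u v T"
  by (simp only: state_def joined_glued_0 map_prod_mem_iff inj_Inl)

section \<open>State and component count after attaching a copy\<close>

context
  fixes n S S'
  assumes S: "S \<subseteq> edges (glued n)" and S': "S' \<subseteq> edges C"
begin

interpretation copy: two_vertex_union "verts (glued n)" "copy n ` verts C" "joined (glued n) S"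
  "map_prod (copy n) (copy n) ` joined C S'" "Inl u" "Inl v"
  using H C finite_verts_glued verts_glued_Int_copy inj_copy
  by unfold_locales (auto intro: equiv_joined equiv_map_prod simp: colored_graph_def)

lemma joined_glued_Suc: "joined (glued (Suc n)) (S \<union> copy_edges n S') = copy.J"
proof -
  have "map_prod (copy n) (copy n) ` adjacency C S' \<subseteq> copy n ` verts C \<times> copy n ` verts C"
    using adjacency_subset[OF C(1) S'] by auto
  with adjacency_subset[OF colored_graph_glued S] show ?thesis
    unfolding copy.J_def
    unfolding joined_adjacency adjacency_glued_Suc verts_glued_Suc
    by (simp only: rtrancl_Un_joined rtrancl_map_prod_Int[OF inj_copy])
qed

lemma copy_terminals: "copy n u' = Inl u" "copy n v' = Inl v"
  using C by (auto simp: copy_vertex_def)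

lemma terminals_joined_copy_iff:
  "(Inl u, Inl v) \<in> map_prod (copy n) (copy n) ` joined C S' \<longleftrightarrow> (u', v') \<in> joined C S'"
  using map_prod_mem_iff[OF inj_copy] by (metis copy_terminals)

text \<open>The terminals are linked in the union iff they are linked on one side. As state 2 means
  linked, this disjunction becomes a maximum.\<close>

lemma state_glued_Suc:
  "state (glued (Suc n)) (Inl u) (Inl v) (S \<union> copy_edges n S') =
     max (state (glued n) (Inl u) (Inl v) S) (state C u' v' S')"
  unfolding state_def joined_glued_Suc copy.J_terminals_iff terminals_joined_copy_iff by auto

lemma num_components_glued_Suc:
  "int (num_components (glued (Suc n)) (S \<union> copy_edges n S')) =
     int (num_components (glued n) S) + int (num_components C S') -
     (if state (glued n) (Inl u) (Inl v) S = 2 \<and> state C u' v' S' = 2 then 1 else 2)"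
  unfolding num_components_def verts_glued_Suc joined_glued_Suc copy.card_quotient_J
    card_quotient_map_prod[OF inj_copy] terminals_joined_copy_iff by (simp add: state_def)

end

section \<open>Multiplicativity of weights and splitting of sums over subgraphs\<close>

lemma weight_glued_Suc:
  fixes x y :: "'c \<Rightarrow> 'k::field"
  assumes "S \<subseteq> edges (glued n)" "S' \<subseteq> edges C"
  shows "weight x y (glued (Suc n)) (S \<union> copy_edges n S') = weight x y (glued n) S * weight x y C S'"
proof -
  \<comment> \<open>One identity serves both products in \<open>weight\<close>: \<open>x\<close>
    over the chosen edges and \<open>y\<close> over the remaining ones.\<close>
  have prod: "(\<Prod>e\<in>D \<union> copy_edges n D'. g (color (glued (Suc n)) e)) =
      (\<Prod>e\<in>D. g (color (glued n) e)) * (\<Prod>e\<in>D'. g (color C e))"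
    if D: "D \<subseteq> edges (glued n)" "D' \<subseteq> edges C" for D D' and g :: "'c \<Rightarrow> 'k"
  proof -
    have "finite D" "finite (copy_edges n D')"
      using D finite_edges_glued C by (auto simp: colored_graph_def dest: finite_subset)
    moreover have "(\<Prod>e\<in>copy_edges n D'. g (color (glued (Suc n)) e)) = (\<Prod>e\<in>D'. g (color C e))"
      by (rule prod.reindex_cong[of "\<lambda>e. Inr (n, e)"]) (auto simp: inj_on_def glue_copies_def)
    ultimately show ?thesis
      using edges_glued_disjoint[OF D(1)]
      by (simp add: prod.union_disjoint) (simp add: glue_copies_def)
  qed
  have "edges (glued (Suc n)) - (S \<union> copy_edges n S') =
      (edges (glued n) - S) \<union> copy_edges n (edges C - S')"
    using edges_glued_disjoint[OF order.refl] assms edges_glued_disjoint[OF assms(1)]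
    unfolding edges_glued_Suc by blast
  then show ?thesis
    unfolding weight_def using assms by (simp add: prod mult_ac)
qed

lemma card_glued_Suc:
  assumes "S \<subseteq> edges (glued n)" "S' \<subseteq> edges C"
  shows "card (S \<union> copy_edges n S') = card S + card S'"
proof -
  have "finite S" "finite (copy_edges n S')"
    using assms finite_edges_glued C by (auto simp: colored_graph_def dest: finite_subset)
  moreover have "card (copy_edges n S') = card S'"
    by (simp add: card_image card_cartesian_product_singleton)
  ultimately show ?thesis
    using edges_glued_disjoint[OF assms(1)] by (simp add: card_Un_disjoint)
qed

lemma sum_Pow_glued_Suc:
  "(\<Sum>D\<in>Pow (edges (glued (Suc n))). g D) =
     (\<Sum>S\<in>Pow (edges (glued n)). \<Sum>S'\<in>Pow (edges C). g (S \<union> copy_edges n S'))"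
proof -
  have "bij_betw (\<lambda>(S, S'). S \<union> copy_edges n S') (Pow (edges (glued n)) \<times> Pow (edges C))
      (Pow (edges (glued (Suc n))))"
  proof (rule bij_betw_byWitness[where
        f' = "\<lambda>D. (D \<inter> edges (glued n), {e \<in> edges C. Inr (n, e) \<in> D})"])
    show "\<forall>z\<in>Pow (edges (glued n)) \<times> Pow (edges C).
        (\<lambda>D. (D \<inter> edges (glued n), {e \<in> edges C. Inr (n, e) \<in> D}))
          ((\<lambda>(S, S'). S \<union> copy_edges n S') z) = z"
      by (auto simp: glue_copies_def)
  qed (auto simp: edges_glued_Suc)
  then show ?thesis
    by (subst sum.reindex_bij_betw[symmetric]) (auto simp: sum.cartesian_product split_def)
qed

end

section \<open>Recurrence of the state sums\<close>

text \<open>The state condition becomes a zero summand, so that the sums range over full power sets,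
  which split under gluing.\<close>

lemma state_sum_altdef:
  assumes "finite (edges H)"
  shows "state_sum x y d H u v j = (\<Sum>S\<in>Pow (edges H).
    if state H u v S = j then weight x y H S * d ^ (card S + 2 * num_components H S) else 0)"
proof -
  have "{S. S \<subseteq> edges H \<and> state H u v S = j} = {S \<in> Pow (edges H). state H u v S = j}" by auto
  then show ?thesis
    unfolding state_sum_def using assms by (simp only: sum.inter_filter finite_Pow_iff)
qed

context gluing
begin

context
  fixes x y :: "'c \<Rightarrow> 'k::field" and d :: 'k
begin

abbreviation Z where "Z n \<equiv> state_sum x y d (glued n) (Inl u) (Inl v)"
abbreviation Z\<^sub>C where "Z\<^sub>C \<equiv> state_sum x y d C u' v'"

text \<open>Gluing normally loses two components, each weighing \<open>d ^ 2\<close>; the factor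
  \<open>d ^ 4\<close> restores them without division. If the terminals are linked on both sides
  only one is lost, whence the extra \<open>d ^ 2\<close>.\<close>

lemma state_sum_glued_Suc:
  "d ^ 4 * Z (Suc n) 1 = Z n 1 * Z\<^sub>C 1" (is ?one)
  "d ^ 4 * Z (Suc n) 2 = Z n 1 * Z\<^sub>C 2 + Z n 2 * Z\<^sub>C 1 + d ^ 2 * (Z n 2 * Z\<^sub>C 2)" (is ?two)
proof -
  let ?m = "\<lambda>K S. weight x y K S * d ^ (card S + 2 * num_components K S)"
  define F where "F j S = (if state (glued n) (Inl u) (Inl v) S = j then ?m (glued n) S else 0)" for j S
  define F' where "F' j S = (if state C u' v' S = j then ?m C S else 0)" for j S
  define K where "K = glued (Suc n)"
  define E where "E j D = (if state K (Inl u) (Inl v) D = j then ?m K D else 0)" for j D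
  have fin: "finite (edges C)" using C by (simp add: colored_graph_def)
  have Z: "Z n j = (\<Sum>S\<in>Pow (edges (glued n)). F j S)" "Z\<^sub>C j = (\<Sum>S\<in>Pow (edges C). F' j S)"
    "Z (Suc n) j = (\<Sum>S\<in>Pow (edges (glued n)). \<Sum>S'\<in>Pow (edges C). E j (S \<union> copy_edges n S'))" for j
    unfolding F_def F'_def E_def K_def
    by (simp_all only: state_sum_altdef[OF finite_edges_glued] state_sum_altdef[OF fin]
        sum_Pow_glued_Suc)
  have m: "d ^ 4 * ?m K (S \<union> copy_edges n S') = ?m (glued n) S * ?m C S' *
      (if state (glued n) (Inl u) (Inl v) S = 2 \<and> state C u' v' S' = 2 then d ^ 2 else 1)"
    if S: "S \<subseteq> edges (glued n)" "S' \<subseteq> edges C" for S S'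
  proof -
    let ?b = "state (glued n) (Inl u) (Inl v) S = 2 \<and> state C u' v' S' = 2"
    have "4 + (card (S \<union> copy_edges n S') + 2 * num_components K (S \<union> copy_edges n S')) =
      (card S + 2 * num_components (glued n) S) + (card S' + 2 * num_components C S') +
      (if ?b then 2 else 0)"
      using num_components_glued_Suc[OF S] card_glued_Suc[OF S] unfolding K_def
      by (simp split: if_splits)
    then have "d ^ 4 * d ^ (card (S \<union> copy_edges n S') + 2 * num_components K (S \<union> copy_edges n S')) =
      d ^ (card S + 2 * num_components (glued n) S) * d ^ (card S' + 2 * num_components C S') *
      (if ?b then d ^ 2 else 1)"
      by (simp flip: power_add split: if_splits)
    moreover have "weight x y K (S \<union> copy_edges n S') = weight x y (glued n) S * weight x y C S'"
      unfolding K_def by (rule weight_glued_Suc[OF S])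
    ultimately show ?thesis by (simp only: mult_ac mult.left_commute[of "d ^ 4"])
  qed
  \<comment> \<open>For given states at most one product on the right can be nonzero: the pair (1,
    1) produces state 1, and each of the other three pairs matches one term of the second
    equation.\<close>
  have E: "d ^ 4 * E 1 (S \<union> copy_edges n S') = F 1 S * F' 1 S'"
    "d ^ 4 * E 2 (S \<union> copy_edges n S') = F 1 S * F' 2 S' + F 2 S * F' 1 S' + d ^ 2 * (F 2 S * F' 2 S')"
    if S: "S \<in> Pow (edges (glued n))" "S' \<in> Pow (edges C)" for S S'
  proof -
    have st: "state K (Inl u) (Inl v) (S \<union> copy_edges n S') =
        max (state (glued n) (Inl u) (Inl v) S) (state C u' v' S')"
      using state_glued_Suc[of S n S'] S unfolding K_def by simp
    note m = m[of S S']
    show "d ^ 4 * E 1 (S \<union> copy_edges n S') = F 1 S * F' 1 S'"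
      using m S state_eq_1_or_2[of C u' v' S'] state_eq_1_or_2[of "glued n" "Inl u" "Inl v" S]
      unfolding E_def F_def F'_def st by auto
    show "d ^ 4 * E 2 (S \<union> copy_edges n S') =
        F 1 S * F' 2 S' + F 2 S * F' 1 S' + d ^ 2 * (F 2 S * F' 2 S')"
      using m S state_eq_1_or_2[of C u' v' S'] state_eq_1_or_2[of "glued n" "Inl u" "Inl v" S]
      unfolding E_def F_def F'_def st by auto
  qed
  show ?one unfolding Z sum_product unfolding sum_distrib_left by (intro sum.cong refl E)
  show ?two unfolding Z sum_product unfolding sum_distrib_left sum.distrib[symmetric]
    by (intro sum.cong refl E)
qed

text \<open>As \<open>T\<close> does not link the terminals, adding \<open>S\<close> gives the state
  of \<open>S\<close> in \<open>C\<close> and changes the component count by that of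
  \<open>S\<close> minus 2. So \<open>T\<close> drops out, and \<open>d ^ 4\<close> cancels the
  doubled 2.\<close>

lemma transfer_sum_eq_state_sum:
  assumes "d \<noteq> 0" "T \<subseteq> edges H" "state H u v T = 1"
  shows "d ^ 4 * transfer_sum x y d H u v T C u' v' j = Z\<^sub>C j"
proof -
  have T: "Inl ` T \<subseteq> edges (glued 0)" using assms by (auto simp: glue_copies_def)
  have st: "state (glued 1) (Inl u) (Inl v) (union_edges T S) = state C u' v' S"
    and nc: "comp_change H u v T C u' v' S = int (num_components C S) - 2" if "S \<subseteq> edges C" for S
    using state_glued_Suc[OF T that] num_components_glued_Suc[OF T that] assms
      state_eq_1_or_2[of C u' v' S]
    unfolding comp_change_def union_edges_def One_nat_def state_glued_0 num_components_glued_0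
    by auto
  have "d ^ 4 * transfer_sum x y d H u v T C u' v' j =
    (\<Sum>S\<in>{S. S \<subseteq> edges C \<and> state C u' v' S = j}.
       d ^ 4 * (weight x y C S * d powi (int (card S) + 2 * (int (num_components C S) - 2))))"
    unfolding transfer_sum_def sum_distrib_left
    by (rule sum.cong) (auto simp: st[unfolded One_nat_def] nc)
  also have "\<dots> = Z\<^sub>C j"
    unfolding state_sum_def
  proof (rule sum.cong)
    fix S
    have "d ^ 4 * d powi (int (card S) + 2 * (int (num_components C S) - 2)) =
      d powi (4 + (int (card S) + 2 * (int (num_components C S) - 2)))"
      by (subst power_int_add) (simp_all add: assms(1))
    also have "\<dots> = d powi int (card S + 2 * num_components C S)"
      by (rule arg_cong[of _ _ "power_int d"]) simp
    finally show "d ^ 4 * (weight x y C S * d powi (int (card S) + 2 * (int (num_components C S) - 2))) =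
      weight x y C S * d ^ (card S + 2 * num_components C S)"
      by (simp only: power_int_of_nat mult_ac)
  qed simp
  finally show ?thesis .
qed

section \<open>State sums with no copy attached\<close>

lemma weight_glued_0: "weight x y (glued 0) (Inl ` S) = weight x y H S"
proof -
  have "edges (glued 0) - Inl ` S = Inl ` (edges H - S)"
    by (auto simp: glue_copies_def)
  then show ?thesis
    by (simp add: weight_def prod.reindex) (simp add: glue_copies_def)
qed

lemma state_sum_glued_0: "Z 0 j = state_sum x y d H u v j"
proof -
  have "Pow (edges (glued 0)) = (`) Inl ` Pow (edges H)"
    by (simp add: glue_copies_def image_Pow_surj)
  moreover have "inj_on ((`) (Inl :: 'e \<Rightarrow> 'e + nat \<times> 'f)) (Pow (edges H))"
    by (auto intro: inj_on_subset inj_on_image simp: inj_on_def)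
  moreover have "finite (edges H)" using H by (simp add: colored_graph_def)
  ultimately show ?thesis
    by (simp only: state_sum_altdef[OF finite_edges_glued] state_sum_altdef sum.reindex o_def
        state_glued_0 weight_glued_0 num_components_glued_0 card_image inj_Inl)
qed

end

end

text \<open>At \<open>t = z\<^sub>1 = z\<^sub>2\<close> the term \<open>k(H)\<close> cancels from the exponents.\<close>

lemma W_poly_eq_state_sum:
  assumes "d \<noteq> 0" "finite (edges H)"
  shows "W_poly x y H d d d =
    d powi (- 1 - int (card (verts H))) * (state_sum x y d H u v 1 + state_sum x y d H u v 2)"
proof -
  have summand: "d powi (int (num_components H (edges H)) - 1) * (w *
      d powi (int (num_components H S) - int (num_components H (edges H))) * d powi nullity H S) =
    d powi (- 1 - int (card (verts H))) * (w * d ^ (card S + 2 * num_components H S))" for w S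
  proof -
    \<comment> \<open>The exponents add up as \<open>(k(H) - 1) + (k(S) - k(H)) + (|S| - |V| + k(S))
      = (- 1 - |V|) + (|S| + 2 k(S))\<close>.\<close>
    have "d powi (int (num_components H (edges H)) - 1) *
        (d powi (int (num_components H S) - int (num_components H (edges H))) * d powi nullity H S) =
      d powi (- 1 - int (card (verts H))) * d powi int (card S + 2 * num_components H S)"
      unfolding nullity_def using assms(1) by (simp only: power_int_add[symmetric] simp_thms)
        (rule arg_cong[of _ _ "power_int d"], simp)
    then show ?thesis by (simp only: power_int_of_nat mult_ac)
  qed
  have "state_sum x y d H u v 1 + state_sum x y d H u v 2 =
    (\<Sum>S\<in>Pow (edges H). weight x y H S * d ^ (card S + 2 * num_components H S))"
    unfolding state_sum_altdef[OF assms(2)] sum.distrib[symmetric]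
    by (intro sum.cong) (auto simp: state_def)
  then show ?thesis
    unfolding W_poly_def by (simp only: sum_distrib_left summand)
qed

section \<open>From diagrams and tangles to the closed formula\<close>

lemma tangle_graph_colored_graph:
  "tangle_graph \<tau> C u v \<Longrightarrow> colored_graph C \<and> u \<in> verts C \<and> v \<in> verts C"
  by (induction rule: tangle_graph.induct) (auto simp: colored_graph_def)

theorem theorem5:
  fixes A d :: "'k::field"
    and x y :: "'c \<Rightarrow> 'k"
    and G :: "('v, 'e, 'c) cgraph" and u v :: 'v
    and C :: "('w, 'f, 'c) cgraph" and u' v' :: 'w
    and \<tau> :: "'c rational_tangle"
    and H1 :: "('h1, 'g1, 'c) cgraph" and u1 v1 :: 'h1 and T1 :: "'g1 set"
    and H2 :: "('h2, 'g2, 'c) cgraph" and u2 v2 :: 'h2 and T2 :: "'g2 set"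
    and S :: "nat \<Rightarrow> 'k" and a11 a12 :: 'k and n :: nat
  assumes "A \<noteq> 0" and "d = loop_value A" and "d \<noteq> 0"
    and "link_diagram_graph G" and "u \<in> verts G" and "v \<in> verts G" and "u \<noteq> v"
    and "tangle_graph \<tau> C u' v'" and "u' \<noteq> v'"
    and "colored_graph H1" and "u1 \<in> verts H1" and "v1 \<in> verts H1"
    and "T1 \<subseteq> edges H1" and "state H1 u1 v1 T1 = 1"
    and "a11 = transfer_sum x y d H1 u1 v1 T1 C u' v' 1"
    and "colored_graph H2" and "u2 \<in> verts H2" and "v2 \<in> verts H2"
    and "T2 \<subseteq> edges H2" and "state H2 u2 v2 T2 = 1"
    and "a12 = transfer_sum x y d H2 u2 v2 T2 C u' v' 2"
    and "\<And>j. S j = state_sum x y d G u v j"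
  shows "W_poly x y (glue_copies n G u v C u' v') d d d =
    d powi (- 1 - int (card (verts (glue_copies n G u v C u' v')))) *
    (a11 ^ n * S 1 * (1 - d powi (- 2)) +
     (a11 + d ^ 2 * a12) ^ n * (S 1 * d powi (- 2) + S 2))"
proof -
  note C = tangle_graph_colored_graph[OF assms(8)]
  have G: "colored_graph G" using assms(4) by (simp add: link_diagram_graph_def)
  interpret G: gluing G u v C u' v'
    using assms G C by unfold_locales auto
  \<comment> \<open>State 1 forces \<open>u1\<close> and \<open>v1\<close> to be distinct, since
    \<open>joined\<close> is reflexive on vertices.\<close>
  interpret H1: gluing H1 u1 v1 C u' v'
    using assms C by unfold_locales (auto simp: state_def joined_def)
  interpret H2: gluing H2 u2 v2 C u' v'
    using assms C by unfold_locales (auto simp: state_def joined_def)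
  let ?Z = "\<lambda>n. state_sum x y d (glue_copies n G u v C u' v') (Inl u) (Inl v)"
  \<comment> \<open>Though possibly computed from different hosts, \<open>a11\<close> and
    \<open>a12\<close> both reduce to state sums of the same \<open>C\<close>.\<close>
  have a11: "d ^ 4 * a11 = state_sum x y d C u' v' 1"
    using H1.transfer_sum_eq_state_sum assms by simp
  have a12: "d ^ 4 * a12 = state_sum x y d C u' v' 2"
    using H2.transfer_sum_eq_state_sum assms by simp
  have d4: "a = b" if "d ^ 4 * a = d ^ 4 * b" for a b using that \<open>d \<noteq> 0\<close> by simp
  have Z1_Suc: "?Z (Suc n) 1 = a11 * ?Z n 1" for n
    by (rule d4) (unfold G.state_sum_glued_Suc(1) a11[symmetric], simp only: mult_ac)
  \<comment> \<open>A linked subgraph stays linked whatever is glued on, so the coefficient of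
    \<open>?Z n 2\<close> collects both state sums of \<open>C\<close>.\<close>
  have Z2_Suc: "?Z (Suc n) 2 = a12 * ?Z n 1 + (a11 + d ^ 2 * a12) * ?Z n 2" for n
    by (rule d4) (unfold G.state_sum_glued_Suc(2) a11[symmetric] a12[symmetric], algebra)
  have dd: "d ^ 2 * d powi (- 2) = 1" using \<open>d \<noteq> 0\<close> by (simp add: power_int_minus)
  have Z1: "?Z n 1 = a11 ^ n * S 1" for n
    by (induction n) (simp_all only: Z1_Suc G.state_sum_glued_0 assms(22) power_Suc power_0 mult_1 mult.assoc)
  \<comment> \<open>\<open>d\<^sup>-\<^sup>2 Z\<^sub>1 + Z\<^sub>2\<close> is the eigenfunctional of the triangular map for the eigenvalue \<open>a11 + d\<^sup>2 a12\<close>.\<close>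
  have Z2: "?Z n 2 + d powi (- 2) * ?Z n 1 = (a11 + d ^ 2 * a12) ^ n * (S 1 * d powi (- 2) + S 2)" for n
  proof (induction n)
    case 0
    show ?case by (simp only: G.state_sum_glued_0 assms(22) power_0 mult_1 mult.commute add.commute)
  next
    case (Suc n)
    \<comment> \<open>By \<open>dd\<close>, \<open>a12\<close> equals
      \<open>d powi (- 2) * (d ^ 2 * a12)\<close>, so \<open>d powi (- 2) * ?Z n 1\<close> also
      receives the factor \<open>a11 + d ^ 2 * a12\<close>.\<close>
    have "?Z (Suc n) 2 + d powi (- 2) * ?Z (Suc n) 1 =
      (a11 + d ^ 2 * a12) * (?Z n 2 + d powi (- 2) * ?Z n 1)"
      unfolding Z1_Suc Z2_Suc using dd by algebra
    then show ?case unfolding Suc.IH by simp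
  qed
  \<comment> \<open>The share \<open>d powi (- 2) * ?Z n 1\<close> goes into the eigenfunctional of
    \<open>Z2\<close>; the rest of \<open>?Z n 1\<close> keeps the factor
    \<open>1 - d powi (- 2)\<close>.\<close>
  have "?Z n 1 + ?Z n 2 = a11 ^ n * S 1 * (1 - d powi (- 2)) +
      (a11 + d ^ 2 * a12) ^ n * (S 1 * d powi (- 2) + S 2)"
    unfolding Z2[symmetric] Z1[symmetric] by (simp add: algebra_simps)
  then show ?thesis
    using W_poly_eq_state_sum[OF \<open>d \<noteq> 0\<close> G.finite_edges_glued] by metis
qed

end
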